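(* Assume that the positions of the vortices $v_1$ and $v_3$ are symmetric to each other by reflection through the origin, and that the positions of $v_2$ and $v_4$ are symmetric to each other by reflection through the origin, with $\mu_i\neq0$ for $i=1,2,3,4$. Then the only rectangular configuration (critical point of $V$ of this form) that is not the square occurs when the line through $v_1,v_3$ and the line through $v_2,v_4$ meet at an angle of $\frac{\pi}{4}$ and the circulation parameters satisfy $\mu_1=-\mu_3$ and $\mu_2=-\mu_4$. That is, a non-square arrangement of this form is a critical point of $V$ exactly when these conditions hold.
   Context: The $(1+4)$-vortex problem: a dominant vortex of circulation $1$ is at the origin, and four infinitesimal vortices $v_1,v_2,v_3,v_4$ with circulation parameters $\mu_i\in\mathbb{R}\setminus\{0\}$ lie on the unit circle, $v_i$ being at the point with polar coordinates $(1,\theta_i)$. Vortices do not collide, so the angles $\theta_i$ are pairwise distinct modulo $2\pi$. Define $$V(\theta)=-\sum_{1\le i<j\le 4}\mu_i\mu_j\left[\cos(\theta_i-\theta_j)+\tfrac12\log\bigl(2-2\cos(\theta_i-\theta_j)\bigr)\right].$$ A configuration of the $(1+4)$-vortex problem with circulation parameters $(\mu_1,\dots,\mu_4)$ means a critical point $\theta=(\theta_1,\dots,\theta_4)$ of $V$. A configuration is rectangular if the four infinitesimal vortices are the vertices of a rectangle inscribed in the unit circle; it is the square configuration if they are the vertices of a square. The angle between two lines is the acute (or right) angle between them. *)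

theory Defs
  imports "HOL-Analysis.Analysis" "HOL-Library.Real_Mod"
begin

(* The vortices are indexed by the four-element type 4, in which the numerals 1, 2, 3, 4 are
   pairwise distinct but 4 = 0.  Hence the linear order on this type reads 4 < 1 < 2 < 3, and
   {1..4} is empty.  The sum below still has one term for each unordered pair of vortices,
   and its terms are symmetric in i and j. *)

definition V :: "real^4 \<Rightarrow> real^4 \<Rightarrow> real" where
  "V \<mu> \<theta> = - (\<Sum>(i, j) | i < j. \<mu> $ i * \<mu> $ j *
      (cos (\<theta> $ i - \<theta> $ j) + 1/2 * ln (2 - 2 * cos (\<theta> $ i - \<theta> $ j))))"

definition no_collision :: "real^4 \<Rightarrow> bool" where
  "no_collision \<theta> \<longleftrightarrow> (\<forall>i j. i \<noteq> j \<longrightarrow> \<not> [\<theta> $ i = \<theta> $ j] (rmod (2 * pi)))"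

definition configuration :: "real^4 \<Rightarrow> real^4 \<Rightarrow> bool" where
  "configuration \<mu> \<theta> \<longleftrightarrow> no_collision \<theta> \<and> (V \<mu> has_derivative (\<lambda>_. 0)) (at \<theta>)"

definition vortex :: "real^4 \<Rightarrow> 4 \<Rightarrow> complex" where
  "vortex \<theta> i = cis (\<theta> $ i)"

(* The vertices a, b, c, d are in cyclic order; d - a = c - b makes abcd a parallelogram. *)

definition rectangle_vertices :: "complex set \<Rightarrow> bool" where
  "rectangle_vertices P \<longleftrightarrow> (\<exists>a b c d. P = {a, b, c, d} \<and> a \<noteq> b \<and> a \<noteq> d \<and>
      d - a = c - b \<and> (b - a) \<bullet> (d - a) = 0)"

definition square_vertices :: "complex set \<Rightarrow> bool" where
  "square_vertices P \<longleftrightarrow> (\<exists>a b c d. P = {a, b, c, d} \<and> a \<noteq> b \<and> a \<noteq> d \<and>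
      d - a = c - b \<and> (b - a) \<bullet> (d - a) = 0 \<and> dist a b = dist a d)"

(* No assumption is made on the labelling of the vertices by the vortices. *)

definition rectangular :: "real^4 \<Rightarrow> bool" where
  "rectangular \<theta> \<longleftrightarrow> rectangle_vertices (range (vortex \<theta>))"

definition square :: "real^4 \<Rightarrow> bool" where
  "square \<theta> \<longleftrightarrow> square_vertices (range (vortex \<theta>))"

(* The angle in [0, pi/2] between the line through p, q and the line through r, s, for
   p \<noteq> q and r \<noteq> s; the absolute value selects the acute (or right) angle. *)

definition line_angle :: "complex \<Rightarrow> complex \<Rightarrow> complex \<Rightarrow> complex \<Rightarrow> real" where
  "line_angle p q r s = arccos (\<bar>(q - p) \<bullet> (s - r)\<bar> / (norm (q - p) * norm (s - r)))"

end

theory Submission imports Defs begin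

text \<open>
  Write \<open>f\<close> for the derivative \<open>f x = sin x * (1 / (2 - 2 * cos x) - 1)\<close> of the pair
  potential. Since \<open>f\<close> is odd and all \<open>\<mu>\<^sub>i\<close> are nonzero, \<open>\<theta>\<close> is a critical point of \<open>V\<close> iff
  \<open>(\<Sum>j. \<mu>\<^sub>j * f (\<theta>\<^sub>i - \<theta>\<^sub>j)) = 0\<close> for every \<open>i\<close> (\<open>configuration_iff\<close>).

  Two antipodal pairs are the ends of two diameters, which bisect each other and have equal
  length, so they always span a rectangle.

  If \<open>v\<^sub>3 = - v\<^sub>1\<close> and \<open>v\<^sub>4 = - v\<^sub>2\<close>, antipodal vortices exert no force on each other because
  \<open>f pi = 0\<close>. With \<open>s\<close> and \<open>c\<close> the sine and cosine of \<open>\<theta>\<^sub>1 - \<theta>\<^sub>2\<close>, every remaining difference of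
  angles has sine \<open>\<plusminus>s\<close> and cosine \<open>\<plusminus>c\<close>, so the factor \<open>s \<noteq> 0\<close> cancels and the four equations read
  \<open>\<mu>\<^sub>2 A = \<mu>\<^sub>4 B\<close>, \<open>\<mu>\<^sub>4 A = \<mu>\<^sub>2 B\<close>, \<open>\<mu>\<^sub>1 A = \<mu>\<^sub>3 B\<close>, \<open>\<mu>\<^sub>3 A = \<mu>\<^sub>1 B\<close>, where
  \<open>A = 1 / (2 - 2 * c) - 1\<close> and \<open>B = 1 / (2 + 2 * c) - 1\<close>.
  The first two force \<open>A\<^sup>2 = B\<^sup>2\<close>. The case \<open>A = B\<close> means \<open>c = 0\<close>, which is the square
  (\<open>square_vertices_antipodal_pairs_iff\<close>). The case \<open>A = - B\<close> means \<open>2 * c\<^sup>2 = 1\<close>, that is, an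
  angle of \<open>pi / 4\<close> between the two diagonals (\<open>line_angle_antipodal\<close>). In that case \<open>A\<close> and \<open>B\<close>
  do not vanish, and the equations reduce to \<open>\<mu>\<^sub>1 = - \<mu>\<^sub>3\<close> and \<open>\<mu>\<^sub>2 = - \<mu>\<^sub>4\<close> (\<open>balance_iff\<close>).
\<close>

section \<open>Critical points as a balance of pair forces\<close>

definition pair_force :: "real \<Rightarrow> real" where
  "pair_force x = sin x * (1 / (2 - 2 * cos x) - 1)"

lemma pair_force_minus: "pair_force (- x) = - pair_force x"
  by (simp add: pair_force_def)

lemma has_field_derivative_pair_potential:
  assumes "cos x \<noteq> 1"
  shows "((\<lambda>x. cos x + 1/2 * ln (2 - 2 * cos x)) has_field_derivative pair_force x) (at x)"
proof -
  have "cos x < 1" using assms cos_le_one[of x] by linarith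
  thus ?thesis unfolding pair_force_def
    by (auto intro!: derivative_eq_intros simp: divide_simps) (simp add: algebra_simps)
qed

text \<open>
  The term \<open>- F i j * h j\<close> equals \<open>F j i * h j\<close>, so the two halves of the left-hand side run over
  the ordered pairs on either side of the diagonal, where \<open>F\<close> vanishes. This makes the
  gradient of \<open>V\<close> independent of the order on the index type.
\<close>

lemma sum_antisymmetric_less:
  fixes F :: "'a::{finite,linorder} \<Rightarrow> 'a \<Rightarrow> real"
  assumes anti: "\<And>i j. F j i = - F i j"
  shows "(\<Sum>(i, j) | i < j. F i j * (h i - h j)) = (\<Sum>i\<in>UNIV. (\<Sum>j\<in>UNIV. F i j) * h i)"
proof -
  have d: "F i i = 0" for i using anti[of i i] by simp
  have e: "F i j * (h i - h j) = F i j * h i + F j i * h j" for i j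
    unfolding anti[of j i] by (simp add: algebra_simps)
  have "(\<Sum>(i, j) | i < j. F i j * (h i - h j)) =
     (\<Sum>(i, j) | i < j. F i j * h i) + (\<Sum>(i, j) | i < j. F j i * h j)"
    by (simp add: e case_prod_unfold sum.distrib)
  also have "(\<Sum>(i, j) | i < j. F j i * h j) = (\<Sum>(i, j) | j < i. F i j * h i)"
    by (rule sum.reindex_bij_witness[of _ prod.swap prod.swap]) auto
  also have "(\<Sum>(i, j) | i < j. F i j * h i) + (\<Sum>(i, j) | j < i. F i j * h i) =
     (\<Sum>(i, j)\<in>{(i, j). i < j} \<union> {(i, j). j < i}. F i j * h i)"
    by (rule sum.union_disjoint[symmetric]) auto
  also have "\<dots> = (\<Sum>(i, j)\<in>UNIV. F i j * h i)"
    by (rule sum.mono_neutral_left) (auto simp: d not_less le_less)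
  also have "\<dots> = (\<Sum>i\<in>UNIV. (\<Sum>j\<in>UNIV. F i j) * h i)"
    by (simp add: sum.cartesian_product sum_distrib_right flip: UNIV_Times_UNIV)
  finally show ?thesis .
qed

lemma no_collision_iff_inj: "no_collision \<theta> \<longleftrightarrow> inj (vortex \<theta>)"
  unfolding no_collision_def inj_def vortex_def cis_eq_iff by blast

lemma no_collision_imp_cos_diff:
  assumes "no_collision \<theta>" "i \<noteq> j"
  shows "cos (\<theta> $ i - \<theta> $ j) \<noteq> 1"
proof
  assume "cos (\<theta> $ i - \<theta> $ j) = 1"
  hence "cis (\<theta> $ i - \<theta> $ j) = 1"
    by (simp add: complex_eq_iff cos_one_sin_zero)
  hence "vortex \<theta> i = vortex \<theta> j"
    by (simp add: vortex_def flip: cis_divide)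
  with assms show False by (simp add: no_collision_iff_inj inj_eq)
qed

text \<open>
  The inner sum may run over all \<open>j\<close>, since \<open>pair_force 0 = 0\<close> removes the self-interaction.
\<close>

lemma V_has_derivative:
  assumes "no_collision \<theta>"
  shows "(V \<mu> has_derivative
    (\<lambda>h. - (\<Sum>i\<in>UNIV. (\<Sum>j\<in>UNIV. \<mu> $ i * \<mu> $ j * pair_force (\<theta> $ i - \<theta> $ j)) * h $ i))) (at \<theta>)"
proof -
  let ?g = "\<lambda>x::real. cos x + 1/2 * ln (2 - 2 * cos x)"
  let ?F = "\<lambda>i j. \<mu> $ i * \<mu> $ j * pair_force (\<theta> $ i - \<theta> $ j)"
  have pair: "((\<lambda>\<theta>. \<mu> $ i * \<mu> $ j * ?g (\<theta> $ i - \<theta> $ j)) has_derivative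
      (\<lambda>h. ?F i j * (h $ i - h $ j))) (at \<theta>)" if "i < j" for i j
  proof -
    have "((\<lambda>\<theta>. \<theta> $ i - \<theta> $ j) has_derivative (\<lambda>h. h $ i - h $ j)) (at \<theta>)"
      by (intro derivative_intros bounded_linear.has_derivative[OF bounded_linear_vec_nth])
    moreover have "(?g has_derivative (*) (pair_force (\<theta> $ i - \<theta> $ j))) (at (\<theta> $ i - \<theta> $ j))"
      using has_field_derivative_pair_potential[OF no_collision_imp_cos_diff[OF assms, of i j]] that
      by (simp add: has_field_derivative_def)
    ultimately have "((\<lambda>\<theta>. ?g (\<theta> $ i - \<theta> $ j)) has_derivative
        (\<lambda>h. pair_force (\<theta> $ i - \<theta> $ j) * (h $ i - h $ j))) (at \<theta>)"
      by (rule has_derivative_compose)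
    from has_derivative_mult_right[OF this, of "\<mu> $ i * \<mu> $ j"] show ?thesis
      by (simp only: mult.assoc)
  qed
  have "((\<lambda>\<theta>. - (\<Sum>p | fst p < snd p.
           \<mu> $ fst p * \<mu> $ snd p * ?g (\<theta> $ fst p - \<theta> $ snd p)))
      has_derivative
        (\<lambda>h. - (\<Sum>p | fst p < snd p. ?F (fst p) (snd p) * (h $ fst p - h $ snd p)))) (at \<theta>)"
    by (intro has_derivative_minus has_derivative_sum pair) simp
  moreover have "?F j i = - ?F i j" for i j
    using pair_force_minus[of "\<theta> $ i - \<theta> $ j"] by simp
  note sum_antisymmetric_less[of ?F, OF this]
  ultimately show ?thesis
    by (simp add: V_def[abs_def] case_prod_unfold)
qed

lemma configuration_iff:
  assumes "no_collision \<theta>" "\<forall>i. \<mu> $ i \<noteq> 0"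
  shows "configuration \<mu> \<theta> \<longleftrightarrow> (\<forall>i. (\<Sum>j\<in>UNIV. \<mu> $ j * pair_force (\<theta> $ i - \<theta> $ j)) = 0)"
proof -
  define G where "G i = (\<Sum>j\<in>UNIV. \<mu> $ i * \<mu> $ j * pair_force (\<theta> $ i - \<theta> $ j))" for i
  have G: "G i = \<mu> $ i * (\<Sum>j\<in>UNIV. \<mu> $ j * pair_force (\<theta> $ i - \<theta> $ j))" for i
    by (simp add: G_def sum_distrib_left mult.assoc)
  have deriv: "(V \<mu> has_derivative (\<lambda>h. - (\<Sum>i\<in>UNIV. G i * h $ i))) (at \<theta>)"
    using V_has_derivative[OF assms(1)] by (simp add: G_def)
  have "(V \<mu> has_derivative (\<lambda>_. 0)) (at \<theta>) \<longleftrightarrow> (\<forall>i. G i = 0)"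
  proof
    assume "(V \<mu> has_derivative (\<lambda>_. 0)) (at \<theta>)"
    from has_derivative_unique[OF deriv this]
    have *: "- (\<Sum>i\<in>UNIV. G i * h $ i) = 0" for h by (rule fun_cong)
    show "\<forall>i. G i = 0"
    proof
      fix k show "G k = 0" using *[of "axis k 1"]
        by (simp add: axis_def if_distrib[of "(*) _"] cong: if_cong)
    qed
  next
    assume "\<forall>i. G i = 0"
    thus "(V \<mu> has_derivative (\<lambda>_. 0)) (at \<theta>)" using deriv by simp
  qed
  thus ?thesis using assms by (simp add: configuration_def G)
qed

section \<open>Rectangles and squares formed by two antipodal pairs\<close>

lemma rectangle_vertices_antipodal_pairs:
  fixes u v :: complex
  assumes "norm u = norm v" "u \<noteq> v" "u \<noteq> - v"
  shows "rectangle_vertices {u, v, - u, - v}"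
proof -
  have "(v - u) \<bullet> (- v - u) = 0"
    using assms(1) by (simp add: inner_diff_left inner_diff_right inner_commute dot_square_norm)
  thus ?thesis using assms
    unfolding rectangle_vertices_def
    by (intro exI[of _ u] exI[of _ v] exI[of _ "- u"] exI[of _ "- v"]) auto
qed

lemma dist_eq_dist_minus_iff:
  fixes a b :: "'a::real_inner"
  shows "dist a b = dist a (- b) \<longleftrightarrow> a \<bullet> b = 0"
proof -
  have "dist a b = dist a (- b) \<longleftrightarrow> (dist a b)\<^sup>2 = (dist a (- b))\<^sup>2"
    by (simp add: power2_eq_iff_nonneg)
  also have "\<dots> \<longleftrightarrow> a \<bullet> b = 0"
    by (simp add: dist_norm power2_norm_eq_inner inner_diff_left inner_diff_right
        inner_add_left inner_add_right inner_commute)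
  finally show ?thesis .
qed

text \<open>
  A square on these four points may carry any cyclic labelling \<open>a\<close>, \<open>b\<close>, \<open>c\<close>, \<open>d\<close>. As the points
  sum to \<open>0\<close> and \<open>a + c = b + d\<close>, both of these sums are \<open>0\<close>. Hence opposite vertices are
  antipodal, equality of adjacent sides says that \<open>a\<close> and \<open>b\<close> are orthogonal, and
  \<open>a \<bullet> b\<close> is \<open>u \<bullet> v\<close> up to sign.
\<close>

lemma square_vertices_antipodal_pairs_iff:
  fixes u v :: complex
  assumes "norm u = norm v" "u \<noteq> v" "u \<noteq> - v"
  shows "square_vertices {u, v, - u, - v} \<longleftrightarrow> u \<bullet> v = 0"
proof
  assume "square_vertices {u, v, - u, - v}"
  then obtain a b c d where P: "{u, v, - u, - v} = {a, b, c, d}"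
    and par: "d - a = c - b" and eq: "dist a b = dist a d"
    unfolding square_vertices_def by blast
  have "u \<noteq> 0" "v \<noteq> 0" using assms by auto
  hence "u \<noteq> - u" "v \<noteq> - v" by (auto simp: complex_eq_iff)
  moreover have "v \<noteq> - u" using assms(3) by auto
  ultimately have uv: "card {u, v, - u, - v} = 4" "\<Sum>{u, v, - u, - v} = 0"
    using assms(2,3) by simp_all
  hence "card {a, b, c, d} = 4" by (simp add: P)
  hence dis: "distinct [a, b, c, d]" using card_distinct[of "[a, b, c, d]"] by simp
  have "a + b + c + d = 0" using uv(2) dis unfolding P by (simp add: add_ac)
  moreover have "a + c = b + d" using par by (simp add: algebra_simps)
  ultimately have "2 * (a + c) = 0" "2 * (b + d) = 0" by algebra+
  hence "a + c = 0" "b + d = 0" unfolding mult_eq_0_iff by simp_all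
  hence c: "c = - a" and d: "d = - b" by (simp_all add: eq_neg_iff_add_eq_0 add.commute)
  have "a \<bullet> b = 0" using eq d by (simp add: dist_eq_dist_minus_iff)
  moreover have "a \<in> {u, v, - u, - v}" "b \<in> {u, v, - u, - v}" "a \<noteq> b" "b \<noteq> - a"
    using P dis c by auto
  ultimately show "u \<bullet> v = 0" by (auto simp: inner_commute)
next
  assume uv: "u \<bullet> v = 0"
  have "(v - u) \<bullet> (- v - u) = 0"
    using assms(1) by (simp add: inner_diff_left inner_diff_right inner_commute dot_square_norm)
  moreover have "dist u v = dist u (- v)" using uv by (simp add: dist_eq_dist_minus_iff)
  ultimately show "square_vertices {u, v, - u, - v}"
    using assms unfolding square_vertices_def
    by (intro exI[of _ u] exI[of _ v] exI[of _ "- u"] exI[of _ "- v"]) auto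
qed

lemma line_angle_antipodal:
  assumes "norm u = 1" "norm v = 1"
  shows "line_angle u (- u) v (- v) = pi / 4 \<longleftrightarrow> 2 * (u \<bullet> v)\<^sup>2 = 1"
proof -
  have e: "- u - u = - 2 *\<^sub>R u" "- v - v = - 2 *\<^sub>R v" by (simp_all add: scaleR_2)
  have n: "line_angle u (- u) v (- v) = arccos \<bar>u \<bullet> v\<bar>"
    unfolding line_angle_def e using assms by (simp add: abs_mult)
  have b: "\<bar>u \<bullet> v\<bar> \<le> 1" using Cauchy_Schwarz_ineq2[of u v] assms by simp
  have "arccos \<bar>u \<bullet> v\<bar> = pi / 4 \<longleftrightarrow> \<bar>u \<bullet> v\<bar> = cos (pi / 4)"
  proof
    show "\<bar>u \<bullet> v\<bar> = cos (pi / 4)" if "arccos \<bar>u \<bullet> v\<bar> = pi / 4"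
      using cos_arccos_abs[of "\<bar>u \<bullet> v\<bar>"] b by (simp add: that)
    show "arccos \<bar>u \<bullet> v\<bar> = pi / 4" if "\<bar>u \<bullet> v\<bar> = cos (pi / 4)"
      unfolding that by (rule arccos_cos) auto
  qed
  also have "\<dots> \<longleftrightarrow> \<bar>u \<bullet> v\<bar>\<^sup>2 = (cos (pi / 4))\<^sup>2"
    by (subst power2_eq_iff_nonneg) (auto simp: cos_45)
  also have "\<dots> \<longleftrightarrow> 2 * (u \<bullet> v)\<^sup>2 = 1"
    by (auto simp: cos_45 power_divide)
  finally show ?thesis unfolding n .
qed

section \<open>Solving the balance equations\<close>

text \<open>
  Here \<open>c\<close> is the cosine of the angle between the radii of \<open>v\<^sub>1\<close> and \<open>v\<^sub>2\<close>, and \<open>A\<close> and \<open>B\<close> are the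
  pair forces at cosine \<open>c\<close> and \<open>- c\<close>, divided by the sine. Eliminating
  \<open>m4\<close> gives \<open>m2 * (A - B) * (A + B) = 0\<close>, where \<open>A - B\<close> is a nonzero multiple of \<open>c\<close> and \<open>A + B\<close> a
  nonzero multiple of \<open>2 * c\<^sup>2 - 1\<close>.
\<close>

lemma balance_iff:
  fixes c :: real
  assumes "m2 \<noteq> 0" "c \<noteq> 1" "c \<noteq> - 1" "c \<noteq> 0"
  defines "A \<equiv> 1 / (2 - 2 * c) - 1" and "B \<equiv> 1 / (2 + 2 * c) - 1"
  shows "m2 * A = m4 * B \<and> m4 * A = m2 * B \<and> m1 * A = m3 * B \<and> m3 * A = m1 * B \<longleftrightarrow>
     2 * c\<^sup>2 = 1 \<and> m1 = - m3 \<and> m2 = - m4" (is "?L \<longleftrightarrow> ?R")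
proof -
  have nz: "2 - 2 * c \<noteq> 0" "2 + 2 * c \<noteq> 0" using assms by auto
  have diff: "A - B = c / (1 - c\<^sup>2)"
    using nz by (simp add: A_def B_def divide_simps power2_eq_square) algebra
  have add: "A + B = (2 * c\<^sup>2 - 1) / (1 - c\<^sup>2)"
    using nz by (simp add: A_def B_def divide_simps power2_eq_square) algebra
  have c2: "1 - c\<^sup>2 \<noteq> 0" using assms by (simp add: power2_eq_1_iff)
  have AB: "A \<noteq> B" using diff c2 assms by auto
  have AB': "A = - B \<longleftrightarrow> 2 * c\<^sup>2 = 1" using add c2 by (auto simp: eq_neg_iff_add_eq_0)
  show ?thesis
  proof
    assume L: ?L
    hence "m2 * (A - B) * (A + B) = 0" by algebra
    hence A: "A = - B" using AB assms by (simp add: eq_neg_iff_add_eq_0)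
    with AB have "B \<noteq> 0" by auto
    have "(m1 + m3) * B = 0" "(m2 + m4) * B = 0" using L A by (simp_all add: algebra_simps)
    with \<open>B \<noteq> 0\<close> have "m1 = - m3" "m2 = - m4" by (simp_all add: eq_neg_iff_add_eq_0)
    thus ?R using A AB' by simp
  next
    assume ?R thus ?L using AB' by auto
  qed
qed

section \<open>The rectangular configurations\<close>

theorem theorem7:
  fixes \<mu> \<theta> :: "real^4"
  assumes "\<forall>i. \<mu> $ i \<noteq> 0"
    and "no_collision \<theta>"
    and "vortex \<theta> 3 = - vortex \<theta> 1"
    and "vortex \<theta> 4 = - vortex \<theta> 2"
  shows "rectangular \<theta> \<and>
    (configuration \<mu> \<theta> \<and> \<not> square \<theta> \<longleftrightarrow>
      line_angle (vortex \<theta> 1) (vortex \<theta> 3) (vortex \<theta> 2) (vortex \<theta> 4) = pi / 4 \<and>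
      \<mu> $ 1 = - \<mu> $ 3 \<and> \<mu> $ 2 = - \<mu> $ 4)"
proof -
  let ?u = "vortex \<theta> 1" and ?v = "vortex \<theta> 2"
  define c where "c = cos (\<theta> $ 1 - \<theta> $ 2)"
  define s where "s = sin (\<theta> $ 1 - \<theta> $ 2)"
  have unit: "norm ?u = 1" "norm ?v = 1" by (simp_all add: vortex_def)
  have ne: "?u \<noteq> ?v" "?u \<noteq> - ?v"
    using assms(2) inj_eq[of "vortex \<theta>"] unfolding assms(4)[symmetric] no_collision_iff_inj
    by auto
  have range: "range (vortex \<theta>) = {?u, ?v, - ?u, - ?v}"
    by (simp add: UNIV_4 assms)
  have inner: "?u \<bullet> ?v = c"
    by (simp add: vortex_def inner_complex_def c_def cos_diff)
  have sq: "square \<theta> \<longleftrightarrow> c = 0"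
    using square_vertices_antipodal_pairs_iff[of ?u ?v] unit ne
    by (simp add: square_def range inner)
  have angle: "line_angle ?u (vortex \<theta> 3) ?v (vortex \<theta> 4) = pi / 4 \<longleftrightarrow> 2 * c\<^sup>2 = 1"
    using line_angle_antipodal[OF unit] by (simp add: assms inner)
  have opposite: "cos (\<theta> $ 3) = - cos (\<theta> $ 1)" "sin (\<theta> $ 3) = - sin (\<theta> $ 1)"
      "cos (\<theta> $ 4) = - cos (\<theta> $ 2)" "sin (\<theta> $ 4) = - sin (\<theta> $ 2)"
    using assms(3,4) by (simp_all add: vortex_def complex_eq_iff)
  have c1: "c \<noteq> 1" using no_collision_imp_cos_diff[OF assms(2), of 1 2] by (simp add: c_def)
  have "cos (\<theta> $ 1 - \<theta> $ 4) = - c" by (simp add: c_def cos_diff opposite)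
  with no_collision_imp_cos_diff[OF assms(2), of 1 4] have c2: "c \<noteq> - 1" by auto
  have "s\<^sup>2 + c\<^sup>2 = 1" by (simp add: s_def c_def)
  with c1 c2 have s0: "s \<noteq> 0" by (auto simp: power2_eq_1_iff)
  define A where "A = 1 / (2 - 2 * c) - 1"
  define B where "B = 1 / (2 + 2 * c) - 1"
  have trig: "cos (\<theta> $ 1 - \<theta> $ 2) = c" "cos (\<theta> $ 2 - \<theta> $ 1) = c"
    "cos (\<theta> $ 3 - \<theta> $ 4) = c" "cos (\<theta> $ 4 - \<theta> $ 3) = c"
    "cos (\<theta> $ 1 - \<theta> $ 4) = - c" "cos (\<theta> $ 4 - \<theta> $ 1) = - c"
    "cos (\<theta> $ 3 - \<theta> $ 2) = - c" "cos (\<theta> $ 2 - \<theta> $ 3) = - c"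
    "sin (\<theta> $ 1 - \<theta> $ 2) = s" "sin (\<theta> $ 2 - \<theta> $ 1) = - s"
    "sin (\<theta> $ 3 - \<theta> $ 4) = s" "sin (\<theta> $ 4 - \<theta> $ 3) = - s"
    "sin (\<theta> $ 1 - \<theta> $ 4) = - s" "sin (\<theta> $ 4 - \<theta> $ 1) = s"
    "sin (\<theta> $ 3 - \<theta> $ 2) = - s" "sin (\<theta> $ 2 - \<theta> $ 3) = s"
    "sin (\<theta> $ 1 - \<theta> $ 3) = 0" "sin (\<theta> $ 3 - \<theta> $ 1) = 0"
    "sin (\<theta> $ 2 - \<theta> $ 4) = 0" "sin (\<theta> $ 4 - \<theta> $ 2) = 0"
    by (simp_all add: c_def s_def cos_diff sin_diff opposite)
  have "configuration \<mu> \<theta> \<longleftrightarrow>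
    (\<mu> $ 2 * (s * A) - \<mu> $ 4 * (s * B) = 0 \<and> \<mu> $ 3 * (s * B) - \<mu> $ 1 * (s * A) = 0 \<and>
     \<mu> $ 4 * (s * A) - \<mu> $ 2 * (s * B) = 0 \<and> \<mu> $ 1 * (s * B) - \<mu> $ 3 * (s * A) = 0)"
    unfolding configuration_iff[OF assms(2,1)] forall_4 sum_4 pair_force_def
    by (simp add: trig A_def B_def)
  also have "\<dots> \<longleftrightarrow> \<mu> $ 2 * A = \<mu> $ 4 * B \<and> \<mu> $ 4 * A = \<mu> $ 2 * B \<and>
      \<mu> $ 1 * A = \<mu> $ 3 * B \<and> \<mu> $ 3 * A = \<mu> $ 1 * B"
    using s0 by (auto simp: mult.left_commute[of _ s])
  finally have conf: "configuration \<mu> \<theta> \<longleftrightarrow> \<dots>" .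
  have "c \<noteq> 0 \<Longrightarrow> configuration \<mu> \<theta> \<longleftrightarrow> 2 * c\<^sup>2 = 1 \<and> \<mu> $ 1 = - \<mu> $ 3 \<and> \<mu> $ 2 = - \<mu> $ 4"
    unfolding conf A_def B_def using assms(1) c1 c2 by (intro balance_iff) auto
  hence "configuration \<mu> \<theta> \<and> \<not> square \<theta> \<longleftrightarrow>
      line_angle ?u (vortex \<theta> 3) ?v (vortex \<theta> 4) = pi / 4 \<and> \<mu> $ 1 = - \<mu> $ 3 \<and> \<mu> $ 2 = - \<mu> $ 4"
    unfolding angle sq by (cases "c = 0") auto
  moreover have "rectangular \<theta>"
    using rectangle_vertices_antipodal_pairs[of ?u ?v] unit ne by (simp add: rectangular_def range)
  ultimately show ?thesis by blast
qed

end
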